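(* $$\widehat{\mathsf{LLPO}}\circ\widehat{\mathsf{LLPO}}\leq_{\mathrm{sW}}\widehat{\mathsf{LLPO}}.$$
   Context: $\mathsf{LLPO}:\subseteq\mathbb{N}^{\mathbb{N}}\rightrightarrows\mathbb{N}$ has domain $\{p: p(k)\neq0\text{ for at most one }k\}$ and values in $\{0,1\}$, with $0\in\mathsf{LLPO}(p)\iff(\forall n)\,p(2n)=0$ and $1\in\mathsf{LLPO}(p)\iff(\forall n)\,p(2n+1)=0$. Its parallelization, regarded as a multi-valued map $\widehat{\mathsf{LLPO}}:\subseteq\mathbb{N}^{\mathbb{N}}\rightrightarrows\mathbb{N}^{\mathbb{N}}$, is $\widehat{\mathsf{LLPO}}\langle p_0,p_1,\dots\rangle=\{q:(\forall k)\,q(k)\in\mathsf{LLPO}(p_k)\}$, defined when all $p_k\in\mathrm{dom}(\mathsf{LLPO})$, where $\langle p_0,p_1,\dots\rangle\langle k,n\rangle=p_k(n)$ with a computable bijective pairing on $\mathbb{N}$. Composition of multi-valued functions $f:\subseteq X\rightrightarrows Y$, $g:\subseteq Y\rightrightarrows Z$: $\mathrm{dom}(g\circ f)=\{x\in\mathrm{dom}(f): f(x)\subseteq\mathrm{dom}(g)\}$ and $(g\circ f)(x)=\{z:(\exists y\in f(x))\,z\in g(y)\}$. A realizer of a multi-valued $f:\subseteq\mathbb{N}^{\mathbb{N}}\rightrightarrows\mathbb{N}^{\mathbb{N}}$ ($\mathbb{N}^{\mathbb{N}}$ being represented by the identity) is a partial function $F:\subseteq\mathbb{N}^{\mathbb{N}}\to\mathbb{N}^{\mathbb{N}}$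 with $F(p)$ defined and $F(p)\in f(p)$ for all $p\in\mathrm{dom}(f)$. Strong Weihrauch reducibility: $f\leq_{\mathrm{sW}}g$ iff there are computable $H,K:\subseteq\mathbb{N}^{\mathbb{N}}\to\mathbb{N}^{\mathbb{N}}$ such that $H\circ G\circ K$ is a realizer of $f$ for every realizer $G$ of $g$. *)

theory Defs
  imports Main "HOL-Library.Nat_Bijection"
begin

type_synonym baire = "nat \<Rightarrow> nat"

section \<open>Computable partial functions on Baire space\<close>

text \<open>
  Partial recursive functions relative to a function \<open>p\<close>, with a big-step semantics:
  \<open>oeval p e xs y\<close> says that program \<open>e\<close> with oracle \<open>p\<close> halts on the arguments \<open>xs\<close>
  with value \<open>y\<close>. The program does not depend on the oracle.
\<close>

datatype orecf =
    Zero
  | Succ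
  | Proj nat
  | Oracle
  | Comp orecf "orecf list"
  | Prec orecf orecf
  | Mu orecf

inductive oeval :: "baire \<Rightarrow> orecf \<Rightarrow> nat list \<Rightarrow> nat \<Rightarrow> bool" for p :: baire where
  zero: "oeval p Zero xs 0"
| succ: "oeval p Succ [x] (Suc x)"
| proj: "i < length xs \<Longrightarrow> oeval p (Proj i) xs (xs ! i)"
| query: "oeval p Oracle [x] (p x)"
| comp: "list_all2 (\<lambda>g y. oeval p g xs y) gs ys \<Longrightarrow> oeval p f ys z
    \<Longrightarrow> oeval p (Comp f gs) xs z"
| prec_0: "oeval p f xs y \<Longrightarrow> oeval p (Prec f g) (0 # xs) y"
| prec_Suc: "oeval p (Prec f g) (n # xs) y \<Longrightarrow> oeval p g (n # y # xs) z
    \<Longrightarrow> oeval p (Prec f g) (Suc n # xs) z"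
| mu: "oeval p f (n # xs) 0 \<Longrightarrow> (\<forall>m<n. \<exists>y. oeval p f (m # xs) (Suc y))
    \<Longrightarrow> oeval p (Mu f) xs n"

inductive_cases oeval_ZeroE: "oeval p Zero xs y"
inductive_cases oeval_SuccE: "oeval p Succ xs y"
inductive_cases oeval_ProjE: "oeval p (Proj i) xs y"
inductive_cases oeval_OracleE: "oeval p Oracle xs y"
inductive_cases oeval_CompE: "oeval p (Comp f gs) xs y"
inductive_cases oeval_Prec_0E: "oeval p (Prec f g) (0 # xs) y"
inductive_cases oeval_Prec_SucE: "oeval p (Prec f g) (Suc n # xs) y"
inductive_cases oeval_MuE: "oeval p (Mu f) xs y"

lemma oeval_deterministic: "oeval p e xs y \<Longrightarrow> oeval p e xs y' \<Longrightarrow> y' = y"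
proof (induction arbitrary: y' rule: oeval.induct)
  case (zero xs)
  then show ?case by (rule oeval_ZeroE)
next
  case (succ x)
  then show ?case by (rule oeval_SuccE) simp
next
  case (proj i xs)
  from proj.prems show ?case by (rule oeval_ProjE)
next
  case (query x)
  then show ?case by (rule oeval_OracleE) simp
next
  case (comp xs gs ys f z)
  from comp.prems obtain ys' where ys': "list_all2 (\<lambda>g y. oeval p g xs y) gs ys'"
    and z: "oeval p f ys' y'"
    by (rule oeval_CompE)
  have "ys' = ys"
  proof (rule nth_equalityI)
    show len: "length ys' = length ys"
      by (rule trans[OF list_all2_lengthD[OF ys', symmetric] list_all2_lengthD[OF comp.IH(1)]])
    show "ys' ! i = ys ! i" if "i < length ys'" for i
    proof -
      from that len have "i < length ys" by simp
      from list_all2_nthD2[OF comp.IH(1) this] list_all2_nthD2[OF ys' that]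
      show ?thesis by simp
    qed
  qed
  with z have "oeval p f ys y'" by simp
  then show ?case by (rule comp.IH(2))
next
  case (prec_0 f xs y g)
  from prec_0.prems have "oeval p f xs y'" by (rule oeval_Prec_0E)
  then show ?case by (rule prec_0.IH)
next
  case (prec_Suc f g n xs y z)
  from prec_Suc.prems obtain v where v: "oeval p (Prec f g) (n # xs) v"
    and y': "oeval p g (n # v # xs) y'"
    by (rule oeval_Prec_SucE)
  from v have "v = y" by (rule prec_Suc.IH(1))
  with y' have "oeval p g (n # y # xs) y'" by simp
  then show ?case by (rule prec_Suc.IH(2))
next
  case (mu f n xs)
  from mu.prems have 0: "oeval p f (y' # xs) 0"
    by (rule oeval_MuE)
  from mu.prems have less: "\<forall>m<y'. \<exists>y. oeval p f (m # xs) (Suc y)"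
    by (rule oeval_MuE)
  have "\<not> n < y'"
  proof
    assume "n < y'"
    with less obtain y where "oeval p f (n # xs) (Suc y)" by blast
    then have "Suc y = 0" by (rule mu.IH(1))
    then show False by simp
  qed
  moreover have "\<not> y' < n"
  proof
    assume "y' < n"
    with mu.IH(2) obtain y where "\<forall>z. oeval p f (y' # xs) z \<longrightarrow> z = Suc y" by meson
    from this[rule_format, OF 0] show False by simp
  qed
  ultimately show ?case by simp
qed

text \<open>
  As in computable analysis, a partial function \<open>F\<close> on Baire space is computable if one
  machine with oracle access to the input \<open>p\<close> produces all values of \<open>F p\<close> whenever
  \<open>p\<close> is in the domain of \<open>F\<close>; nothing is required of it outside the domain.
\<close>

definition computable :: "(baire \<rightharpoonup> baire) \<Rightarrow> bool" where
  "computable F \<longleftrightarrow> (\<exists>e. \<forall>p q. F p = Some q \<longrightarrow> (\<forall>n. oeval p e [n] (q n)))"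


section \<open>Multi-valued functions and strong Weihrauch reducibility\<close>

text \<open>
  A partial multi-valued function is represented by its set of values at each point;
  the value is empty exactly outside the domain.
\<close>

type_synonym ('a, 'b) mvfun = "'a \<Rightarrow> 'b set"

definition mv_dom :: "('a, 'b) mvfun \<Rightarrow> 'a set" where
  "mv_dom f = {x. f x \<noteq> {}}"

definition mv_comp :: "('b, 'c) mvfun \<Rightarrow> ('a, 'b) mvfun \<Rightarrow> ('a, 'c) mvfun"
    (infixl "\<circ>\<^sub>m\<^sub>v" 55) where
  "(g \<circ>\<^sub>m\<^sub>v f) x = {z. x \<in> mv_dom f \<and> f x \<subseteq> mv_dom g \<and> (\<exists>y\<in>f x. z \<in> g y)}"

lemma mv_dom_comp: "mv_dom (g \<circ>\<^sub>m\<^sub>v f) = {x \<in> mv_dom f. f x \<subseteq> mv_dom g}"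
  by (auto simp: mv_dom_def mv_comp_def)

definition realizer :: "(baire \<rightharpoonup> baire) \<Rightarrow> (baire, baire) mvfun \<Rightarrow> bool" where
  "realizer F f \<longleftrightarrow> (\<forall>p\<in>mv_dom f. \<exists>q. F p = Some q \<and> q \<in> f p)"

definition sW_reducible :: "(baire, baire) mvfun \<Rightarrow> (baire, baire) mvfun \<Rightarrow> bool"
    (infix "\<le>\<^sub>s\<^sub>W" 50) where
  "f \<le>\<^sub>s\<^sub>W g \<longleftrightarrow> (\<exists>H K. computable H \<and> computable K \<and>
     (\<forall>G. realizer G g \<longrightarrow> realizer (H \<circ>\<^sub>m G \<circ>\<^sub>m K) f))"


section \<open>LLPO and parallelization\<close>

definition LLPO :: "(baire, nat) mvfun" where
  "LLPO p = {i. (\<forall>j k. p j \<noteq> 0 \<and> p k \<noteq> 0 \<longrightarrow> j = k) \<and>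
     (i = 0 \<and> (\<forall>n. p (2 * n) = 0) \<or> i = 1 \<and> (\<forall>n. p (2 * n + 1) = 0))}"

lemma mv_dom_LLPO: "mv_dom LLPO = {p. \<forall>j k. p j \<noteq> 0 \<and> p k \<noteq> 0 \<longrightarrow> j = k}" (is "_ = Collect ?D")
proof -
  have "LLPO p \<noteq> {} \<longleftrightarrow> ?D p" for p
  proof
    assume "LLPO p \<noteq> {}"
    then show "?D p" unfolding LLPO_def by blast
  next
    assume D: "?D p"
    have "0 \<in> LLPO p \<or> 1 \<in> LLPO p"
    proof (rule ccontr)
      assume "\<not> ?thesis"
      with D have "\<not> (\<forall>n. p (2 * n) = 0)" "\<not> (\<forall>n. p (2 * n + 1) = 0)"
        unfolding LLPO_def mem_Collect_eq by argo+
      then obtain m n where "p (2 * m) \<noteq> 0" "p (2 * n + 1) \<noteq> 0" by meson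
      with D have "2 * m = 2 * n + 1" by blast
      then show False by presburger
    qed
    then show "LLPO p \<noteq> {}" by blast
  qed
  then show ?thesis unfolding mv_dom_def by simp
qed

text \<open>The \<open>k\<close>-th component of \<open>\<langle>p\<^sub>0, p\<^sub>1, \<dots>\<rangle>\<close>, via the Cantor pairing function.\<close>

definition component :: "baire \<Rightarrow> nat \<Rightarrow> baire" where
  "component p k = (\<lambda>n. p (prod_encode (k, n)))"

definition parallelization :: "(baire, nat) mvfun \<Rightarrow> (baire, baire) mvfun" where
  "parallelization f p = {q. \<forall>k. q k \<in> f (component p k)}"

lemma mv_dom_parallelization:
  "mv_dom (parallelization f) = {p. \<forall>k. component p k \<in> mv_dom f}"
proof -
  have "(\<exists>q. \<forall>k. q k \<in> f (component p k)) \<longleftrightarrow> (\<forall>k. f (component p k) \<noteq> {})" for p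
    unfolding ex_in_conv[symmetric] by (rule choice_iff[symmetric])
  then show ?thesis
    unfolding mv_dom_def parallelization_def by simp
qed

abbreviation LLPO_hat :: "(baire, baire) mvfun" where
  "LLPO_hat \<equiv> parallelization LLPO"

end

theory Submission
  imports Defs
begin

text \<open>
  The domain convention for compositions makes the first application of the parallelized
  \<open>LLPO\<close> almost deterministic. Let \<open>p\<close> be in the domain of the composition and write
  \<open>p\<^bsub>k,n\<^esub>\<close> for its component number \<open>\<langle>k,n\<rangle>\<close>. The intermediate results \<open>q\<close> range over a full
  product: each bit \<open>q\<langle>k,n\<rangle>\<close> may be chosen independently from \<open>LLPO p\<^bsub>k,n\<^esub>\<close>. All of these \<open>q\<close>
  must be legal inputs for the second application, in particular the one that answers \<open>1\<close>
  wherever possible. Hence for each \<open>k\<close> at most one \<open>n\<close> admits the answer \<open>1\<close>, that is, has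
  \<open>p\<^bsub>k,n\<^esub>\<close> vanishing at all odd positions.

  A nonzero entry of \<open>p\<^bsub>k,n\<^esub>\<close> at an even position makes all its odd positions vanish. So for fixed
  \<open>k\<close> there is at most one nonzero entry altogether among the even positions of all the sequences
  \<open>p\<^bsub>k,n\<^esub>\<close>. Conversely, the intermediate result that answers \<open>1\<close> only where it is forced to has
  \<open>q\<langle>k,n\<rangle> = 1\<close> exactly if such an entry occurs in \<open>p\<^bsub>k,n\<^esub>\<close>. The second application asks whether
  this happens for no even \<open>n\<close> or for no odd \<open>n\<close>, which is a single instance of \<open>LLPO\<close> once
  the entries \<open>p\<^bsub>k,n\<^esub>(2m)\<close> are listed such that the parity of the position is the parity of \<open>n\<close>:
  the position \<open>2\<langle>n,m\<rangle> + b\<close> of the new \<open>k\<close>-th instance carries \<open>p\<^bsub>k,2n+b\<^esub>(2m)\<close>.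

  So \<open>K\<close> is a mere rearrangement of the input, by the index map \<open>source_index\<close>, and \<open>H\<close> is the
  identity. The combinatorial content is in \<open>LLPO_hat_rearrange_subset_comp\<close>
  and \<open>rearrange_in_dom\<close>; the rest shows that \<open>source_index\<close> is recursive.
\<close>

section \<open>Total functions recursive in the oracle\<close>

text \<open>
  Programs are handled through the functions that they compute. Arguments are kept as a list of
  fixed length \<open>k\<close> so that the closure properties below apply to all arities alike.
\<close>

definition oracle_recursive :: "nat \<Rightarrow> (baire \<Rightarrow> nat list \<Rightarrow> nat) \<Rightarrow> bool" where
  "oracle_recursive k f \<longleftrightarrow> (\<exists>e. \<forall>p xs. length xs = k \<longrightarrow> oeval p e xs (f p xs))"

lemma oracle_recursive_cong:
  assumes "oracle_recursive k f" "\<And>p xs. length xs = k \<Longrightarrow> f p xs = g p xs"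
  shows "oracle_recursive k g"
  using assms unfolding oracle_recursive_def by metis

lemma oracle_recursive_zero: "oracle_recursive k (\<lambda>p xs. 0)"
  unfolding oracle_recursive_def by (blast intro: oeval.zero)

lemma oracle_recursive_proj: "i < k \<Longrightarrow> oracle_recursive k (\<lambda>p xs. xs ! i)"
  unfolding oracle_recursive_def by (blast intro: oeval.proj)

lemma oracle_recursive_comp1:
  assumes "oracle_recursive 1 (\<lambda>p xs. g p (xs ! 0))" "oracle_recursive k f"
  shows "oracle_recursive k (\<lambda>p xs. g p (f p xs))"
proof -
  obtain d where d: "\<And>p xs. length xs = 1 \<Longrightarrow> oeval p d xs (g p (xs ! 0))"
    using assms(1) unfolding oracle_recursive_def by blast
  obtain e where e: "\<And>p xs. length xs = k \<Longrightarrow> oeval p e xs (f p xs)"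
    using assms(2) unfolding oracle_recursive_def by blast
  have "oeval p (Comp d [e]) xs (g p (f p xs))" if "length xs = k" for p xs
    using oeval.comp[of p xs "[e]" "[f p xs]" d] e[OF that] d[of "[f p xs]"] by simp
  then show ?thesis unfolding oracle_recursive_def by blast
qed

lemma oracle_recursive_comp2:
  assumes "oracle_recursive 2 (\<lambda>p xs. g p (xs ! 0) (xs ! 1))"
    and "oracle_recursive k f1" "oracle_recursive k f2"
  shows "oracle_recursive k (\<lambda>p xs. g p (f1 p xs) (f2 p xs))"
proof -
  obtain d where d: "\<And>p xs. length xs = 2 \<Longrightarrow> oeval p d xs (g p (xs ! 0) (xs ! 1))"
    using assms(1) unfolding oracle_recursive_def by blast
  obtain e1 where e1: "\<And>p xs. length xs = k \<Longrightarrow> oeval p e1 xs (f1 p xs)"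
    using assms(2) unfolding oracle_recursive_def by blast
  obtain e2 where e2: "\<And>p xs. length xs = k \<Longrightarrow> oeval p e2 xs (f2 p xs)"
    using assms(3) unfolding oracle_recursive_def by blast
  have "oeval p (Comp d [e1, e2]) xs (g p (f1 p xs) (f2 p xs))" if "length xs = k" for p xs
    using oeval.comp[of p xs "[e1, e2]" "[f1 p xs, f2 p xs]" d] e1[OF that] e2[OF that]
      d[of "[f1 p xs, f2 p xs]"] by simp
  then show ?thesis unfolding oracle_recursive_def by blast
qed

lemma oracle_recursive_query:
  assumes "oracle_recursive k f"
  shows "oracle_recursive k (\<lambda>p xs. p (f p xs))"
proof -
  have "oracle_recursive 1 (\<lambda>p xs. p (xs ! 0))"
    unfolding oracle_recursive_def
    by (rule exI[of _ Oracle]) (auto simp: length_Suc_conv intro: oeval.query)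
  from oracle_recursive_comp1[OF this assms] show ?thesis .
qed

lemma oracle_recursive_Suc:
  assumes "oracle_recursive k f"
  shows "oracle_recursive k (\<lambda>p xs. Suc (f p xs))"
proof -
  have "oracle_recursive 1 (\<lambda>p xs. Suc (xs ! 0))"
    unfolding oracle_recursive_def
    by (rule exI[of _ Succ]) (auto simp: length_Suc_conv intro: oeval.succ)
  from oracle_recursive_comp1[OF this assms] show ?thesis .
qed

lemma oracle_recursive_prim_rec:
  assumes f: "oracle_recursive k f" and g: "oracle_recursive (Suc (Suc k)) g"
    and h0: "\<And>p xs. length xs = k \<Longrightarrow> h p (0 # xs) = f p xs"
    and hSuc: "\<And>p xs n. length xs = k \<Longrightarrow> h p (Suc n # xs) = g p (n # h p (n # xs) # xs)"
  shows "oracle_recursive (Suc k) h"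
proof -
  obtain d where d: "\<And>p xs. length xs = k \<Longrightarrow> oeval p d xs (f p xs)"
    using f unfolding oracle_recursive_def by blast
  obtain e where e: "\<And>p xs. length xs = Suc (Suc k) \<Longrightarrow> oeval p e xs (g p xs)"
    using g unfolding oracle_recursive_def by blast
  have "oeval p (Prec d e) (n # xs) (h p (n # xs))" if "length xs = k" for p n xs
  proof (induction n)
    case 0
    show ?case using d[OF that] h0[OF that] by (simp add: oeval.prec_0)
  next
    case (Suc n)
    show ?case
      using oeval.prec_Suc[OF Suc e[of "n # h p (n # xs) # xs"]] hSuc[OF that] that by simp
  qed
  then show ?thesis unfolding oracle_recursive_def
    by (intro exI[of _ "Prec d e"]) (auto simp: length_Suc_conv)
qed

lemma oracle_recursive_least_zero:
  assumes f: "oracle_recursive (Suc k) f"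
    and zero: "\<And>p xs. length xs = k \<Longrightarrow> f p (h p xs # xs) = 0"
    and least: "\<And>p xs m. length xs = k \<Longrightarrow> m < h p xs \<Longrightarrow> f p (m # xs) \<noteq> 0"
  shows "oracle_recursive k h"
proof -
  obtain e where e: "\<And>p xs. length xs = Suc k \<Longrightarrow> oeval p e xs (f p xs)"
    using f unfolding oracle_recursive_def by blast
  have "oeval p (Mu e) xs (h p xs)" if len: "length xs = k" for p xs
  proof (rule oeval.mu)
    show "oeval p e (h p xs # xs) 0"
      using e[of "h p xs # xs" p] zero[OF len, of p] len by simp
    show "\<forall>m<h p xs. \<exists>y. oeval p e (m # xs) (Suc y)"
    proof (intro allI impI)
      fix m assume "m < h p xs"
      then obtain y where "f p (m # xs) = Suc y"
        using least[OF len, of m p] not0_implies_Suc by blast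
      then show "\<exists>y. oeval p e (m # xs) (Suc y)"
        using e[of "m # xs" p] len by auto
    qed
  qed
  then show ?thesis unfolding oracle_recursive_def by blast
qed


section \<open>Arithmetic and the pairing function\<close>

lemma oracle_recursive_add:
  assumes "oracle_recursive k f1" "oracle_recursive k f2"
  shows "oracle_recursive k (\<lambda>p xs. f1 p xs + f2 p xs)"
proof -
  have "oracle_recursive (Suc 1) (\<lambda>p xs. xs ! 0 + xs ! 1)"
    by (rule oracle_recursive_prim_rec[where f = "\<lambda>p xs. xs ! 0" and g = "\<lambda>p xs. Suc (xs ! 1)"])
      (auto intro!: oracle_recursive_Suc oracle_recursive_proj)
  then have "oracle_recursive 2 (\<lambda>p xs. xs ! 0 + xs ! 1)" by (simp add: numeral_2_eq_2)
  from oracle_recursive_comp2[OF this assms] show ?thesis .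
qed

lemma oracle_recursive_pred:
  assumes "oracle_recursive k f"
  shows "oracle_recursive k (\<lambda>p xs. f p xs - 1)"
proof -
  have "oracle_recursive (Suc 0) (\<lambda>p xs. xs ! 0 - 1)"
    by (rule oracle_recursive_prim_rec[where f = "\<lambda>p xs. 0" and g = "\<lambda>p xs. xs ! 0"])
      (auto intro!: oracle_recursive_zero oracle_recursive_proj)
  then have "oracle_recursive 1 (\<lambda>p xs. xs ! 0 - 1)" by simp
  from oracle_recursive_comp1[OF this assms] show ?thesis .
qed

lemma oracle_recursive_diff:
  assumes "oracle_recursive k f1" "oracle_recursive k f2"
  shows "oracle_recursive k (\<lambda>p xs. f1 p xs - f2 p xs)"
proof -
  \<comment> \<open>Primitive recursion runs over the first argument, hence over the subtrahend.\<close>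
  have "oracle_recursive (Suc 1) (\<lambda>p xs. xs ! 1 - xs ! 0)"
    by (rule oracle_recursive_prim_rec[where f = "\<lambda>p xs. xs ! 0" and g = "\<lambda>p xs. xs ! 1 - 1"])
      (intro oracle_recursive_pred oracle_recursive_proj | simp)+
  then have "oracle_recursive 2 (\<lambda>p xs. xs ! 1 - xs ! 0)" by (simp add: numeral_2_eq_2)
  from oracle_recursive_comp2[OF this assms(2,1)] show ?thesis .
qed

text \<open>
  The recursion uses \<open>Suc n div 2 = n - n div 2\<close>, which avoids a case distinction on the parity.
\<close>

lemma oracle_recursive_half:
  assumes "oracle_recursive k f"
  shows "oracle_recursive k (\<lambda>p xs. f p xs div 2)"
proof -
  have "oracle_recursive (Suc 0) (\<lambda>p xs. xs ! 0 div 2)"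
    by (rule oracle_recursive_prim_rec[where f = "\<lambda>p xs. 0" and g = "\<lambda>p xs. xs ! 0 - xs ! 1"])
      (intro oracle_recursive_zero oracle_recursive_diff oracle_recursive_proj | simp; presburger)+
  then have "oracle_recursive 1 (\<lambda>p xs. xs ! 0 div 2)" by simp
  from oracle_recursive_comp1[OF this assms] show ?thesis .
qed

lemma oracle_recursive_double:
  assumes "oracle_recursive k f"
  shows "oracle_recursive k (\<lambda>p xs. 2 * f p xs)"
  using oracle_recursive_add[OF assms assms] by (simp add: mult_2)

lemma oracle_recursive_parity:
  assumes "oracle_recursive k f"
  shows "oracle_recursive k (\<lambda>p xs. f p xs mod 2)"
  by (rule oracle_recursive_cong[OF oracle_recursive_diff[OF assms
          oracle_recursive_double[OF oracle_recursive_half[OF assms]]]])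
    (simp add: minus_mult_div_eq_mod)

lemma oracle_recursive_triangle:
  assumes "oracle_recursive k f"
  shows "oracle_recursive k (\<lambda>p xs. triangle (f p xs))"
proof -
  have "oracle_recursive (Suc 0) (\<lambda>p xs. triangle (xs ! 0))"
    by (rule oracle_recursive_prim_rec
        [where f = "\<lambda>p xs. 0" and g = "\<lambda>p xs. xs ! 1 + Suc (xs ! 0)"])
      (auto intro!: oracle_recursive_zero oracle_recursive_add oracle_recursive_Suc
        oracle_recursive_proj)
  then have "oracle_recursive 1 (\<lambda>p xs. triangle (xs ! 0))" by simp
  from oracle_recursive_comp1[OF this assms] show ?thesis .
qed

lemma oracle_recursive_prod_encode:
  assumes "oracle_recursive k f1" "oracle_recursive k f2"
  shows "oracle_recursive k (\<lambda>p xs. prod_encode (f1 p xs, f2 p xs))"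
  unfolding prod_encode_def prod.case
  by (intro oracle_recursive_add oracle_recursive_triangle assms)

lemma mono_triangle: "mono triangle"
  by (rule mono_iff_le_Suc[THEN iffD2]) simp

text \<open>
  A pair is decoded by first finding its diagonal: the number \<open>x\<close> lies on the diagonal \<open>s\<close>,
  meaning that its components add up to \<open>s\<close>, if \<open>s\<close> is the least number with
  \<open>x < triangle (Suc s)\<close>.
\<close>

definition diagonal :: "nat \<Rightarrow> nat" where
  "diagonal x = fst (prod_decode x) + snd (prod_decode x)"

lemma eq_triangle_diagonal: "x = triangle (diagonal x) + fst (prod_decode x)"
  using prod_decode_inverse[of x] by (simp add: diagonal_def prod_encode_def split_beta)

lemma oracle_recursive_diagonal:
  assumes "oracle_recursive k f"
  shows "oracle_recursive k (\<lambda>p xs. diagonal (f p xs))"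
proof -
  have "oracle_recursive 1 (\<lambda>p xs. diagonal (xs ! 0))"
  proof (rule oracle_recursive_least_zero
      [where f = "\<lambda>p xs. Suc (xs ! 1) - triangle (Suc (xs ! 0))"])
    show "oracle_recursive (Suc 1) (\<lambda>p xs. Suc (xs ! 1) - triangle (Suc (xs ! 0)))"
      by (intro oracle_recursive_diff oracle_recursive_Suc oracle_recursive_triangle
          oracle_recursive_proj) auto
    fix xs :: "nat list"
    let ?x = "xs ! 0"
    have "fst (prod_decode ?x) \<le> diagonal ?x" by (simp add: diagonal_def)
    then show "Suc ((diagonal ?x # xs) ! 1) - triangle (Suc ((diagonal ?x # xs) ! 0)) = 0"
      using eq_triangle_diagonal[of ?x] by simp
    fix m assume "m < diagonal ?x"
    then have "triangle (Suc m) \<le> triangle (diagonal ?x)"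
      by (intro monoD[OF mono_triangle]) simp
    then have "triangle (Suc m) \<le> ?x"
      using eq_triangle_diagonal[of ?x] by linarith
    then show "Suc ((m # xs) ! 1) - triangle (Suc ((m # xs) ! 0)) \<noteq> 0" by simp
  qed
  from oracle_recursive_comp1[OF this assms] show ?thesis .
qed

lemma oracle_recursive_fst_prod_decode:
  assumes "oracle_recursive k f"
  shows "oracle_recursive k (\<lambda>p xs. fst (prod_decode (f p xs)))"
proof -
  have "x - triangle (diagonal x) = fst (prod_decode x)" for x
    using eq_triangle_diagonal[of x] by linarith
  with oracle_recursive_diff[OF assms oracle_recursive_triangle
      [OF oracle_recursive_diagonal[OF assms]]]
  show ?thesis by simp
qed

lemma oracle_recursive_snd_prod_decode:
  assumes "oracle_recursive k f"
  shows "oracle_recursive k (\<lambda>p xs. snd (prod_decode (f p xs)))"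
  using oracle_recursive_diff[OF oracle_recursive_diagonal[OF assms]
      oracle_recursive_fst_prod_decode[OF assms]]
  by (simp add: diagonal_def)

lemma computable_if_oracle_recursive:
  assumes "oracle_recursive 1 (\<lambda>p xs. F p (xs ! 0))"
  shows "computable (\<lambda>p. Some (F p))"
proof -
  obtain e where "\<And>p xs. length xs = 1 \<Longrightarrow> oeval p e xs (F p (xs ! 0))"
    using assms unfolding oracle_recursive_def by blast
  from this[of "[_]"] show ?thesis
    unfolding computable_def by (intro exI[of _ e]) auto
qed


section \<open>Collapsing the composition into a single instance\<close>

text \<open>
  The position \<open>2\<langle>n,m\<rangle> + b\<close> with \<open>b < 2\<close> of the \<open>k\<close>-th new instance is filled from position
  \<open>2m\<close> of the old component number \<open>\<langle>k, 2n + b\<rangle>\<close>.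
\<close>

definition source_index :: "nat \<Rightarrow> nat" where
  "source_index i = (let k = fst (prod_decode i); j = snd (prod_decode i);
     n = fst (prod_decode (j div 2)); m = snd (prod_decode (j div 2))
   in prod_encode (prod_encode (k, 2 * n + j mod 2), 2 * m))"

definition rearrange :: "baire \<Rightarrow> baire" where
  "rearrange p i = p (source_index i)"

lemma component_rearrange:
  "component (rearrange p) k j =
    component p (prod_encode (k, 2 * fst (prod_decode (j div 2)) + j mod 2))
      (2 * snd (prod_decode (j div 2)))"
  by (simp add: component_def rearrange_def source_index_def)

lemma component_rearrange_encode:
  assumes "b < 2"
  shows "component (rearrange p) k (2 * prod_encode (n, m) + b)
    = component p (prod_encode (k, 2 * n + b)) (2 * m)"
  using assms by (simp add: component_rearrange)

lemma computable_rearrange: "computable (\<lambda>p. Some (rearrange p))"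
  unfolding rearrange_def source_index_def Let_def
  by (intro computable_if_oracle_recursive oracle_recursive_query oracle_recursive_prod_encode
      oracle_recursive_add oracle_recursive_double oracle_recursive_parity oracle_recursive_half
      oracle_recursive_fst_prod_decode oracle_recursive_snd_prod_decode oracle_recursive_proj) simp_all

lemma mem_LLPO_iff:
  assumes "p \<in> mv_dom LLPO"
  shows "i \<in> LLPO p \<longleftrightarrow>
    i = 0 \<and> (\<forall>n. p (2 * n) = 0) \<or> i = 1 \<and> (\<forall>n. p (2 * n + 1) = 0)"
  using assms unfolding LLPO_def mv_dom_LLPO by blast

lemma one_mem_LLPO_if_even_nonzero:
  assumes "p \<in> mv_dom LLPO" "p (2 * m) \<noteq> 0"
  shows "1 \<in> LLPO p"
proof -
  have "p (2 * n + 1) = 0" for n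
  proof (rule ccontr)
    assume "p (2 * n + 1) \<noteq> 0"
    with assms have "2 * m = 2 * n + 1" unfolding mv_dom_LLPO by blast
    then show False by presburger
  qed
  with assms(1) show ?thesis by (simp add: mem_LLPO_iff)
qed

text \<open>
  The values of the inner function form a product set, so one of them has the answer \<open>1\<close>
  at both places in question; it is a legal input for the outer function only if the places agree.
\<close>

lemma at_most_one_answer_one:
  assumes dom: "p \<in> mv_dom LLPO_hat" and sub: "LLPO_hat p \<subseteq> mv_dom LLPO_hat"
    and "1 \<in> LLPO (component p (prod_encode (k, n)))"
    and "1 \<in> LLPO (component p (prod_encode (k, n')))"
  shows "n = n'"
proof -
  obtain q where q: "q \<in> LLPO_hat p" using dom unfolding mv_dom_def by blast
  define q' where "q' = q(prod_encode (k, n) := 1, prod_encode (k, n') := 1)"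
  have "q' \<in> LLPO_hat p"
    using q assms(3,4) by (auto simp: q'_def parallelization_def)
  then have "component q' k \<in> mv_dom LLPO"
    using sub unfolding mv_dom_parallelization by blast
  moreover have "component q' k n \<noteq> 0" "component q' k n' \<noteq> 0"
    by (simp_all add: component_def q'_def)
  ultimately show ?thesis unfolding mv_dom_LLPO by blast
qed

lemma rearrange_in_dom:
  assumes dom: "p \<in> mv_dom LLPO_hat" and sub: "LLPO_hat p \<subseteq> mv_dom LLPO_hat"
  shows "rearrange p \<in> mv_dom LLPO_hat"
proof -
  have compdom: "component p i \<in> mv_dom LLPO" for i
    using dom unfolding mv_dom_parallelization by blast
  have "j = j'"
    if nz: "component (rearrange p) k j \<noteq> 0" "component (rearrange p) k j' \<noteq> 0" for k j j'
  proof -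
    define n m n' m' where nm: "n = fst (prod_decode (j div 2))" "m = snd (prod_decode (j div 2))"
      "n' = fst (prod_decode (j' div 2))" "m' = snd (prod_decode (j' div 2))"
    let ?c = "2 * n + j mod 2" and ?c' = "2 * n' + j' mod 2"
    have nz': "component p (prod_encode (k, ?c)) (2 * m) \<noteq> 0"
      "component p (prod_encode (k, ?c')) (2 * m') \<noteq> 0"
      using nz unfolding component_rearrange nm by simp_all
    have c: "?c = ?c'"
      by (rule at_most_one_answer_one[OF dom sub]; rule one_mem_LLPO_if_even_nonzero[OF compdom];
          rule nz')
    then have "2 * m = 2 * m'"
      using nz' compdom unfolding mv_dom_LLPO by force
    moreover have "n = n'" "j mod 2 = j' mod 2" using c by presburger+
    ultimately have "prod_decode (j div 2) = prod_decode (j' div 2)"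
      by (simp add: nm prod_eq_iff)
    then have "j div 2 = j' div 2" by (metis prod_decode_inverse)
    with \<open>j mod 2 = j' mod 2\<close> show "j = j'" by presburger
  qed
  then show ?thesis unfolding mv_dom_parallelization mv_dom_LLPO by blast
qed

text \<open>
  The witness for the intermediate value answers \<open>1\<close> only where \<open>0\<close> is wrong. Its nonzero bits
  then sit at those \<open>n\<close> whose component has a nonzero entry at an even position,
  and these entries are the ones that the rearranged input carries.
\<close>

lemma LLPO_hat_rearrange_subset_comp:
  assumes dom: "p \<in> mv_dom LLPO_hat" and sub: "LLPO_hat p \<subseteq> mv_dom LLPO_hat"
  shows "LLPO_hat (rearrange p) \<subseteq> (LLPO_hat \<circ>\<^sub>m\<^sub>v LLPO_hat) p"
proof
  fix z assume z: "z \<in> LLPO_hat (rearrange p)"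
  have compdom: "component p i \<in> mv_dom LLPO" for i
    using dom unfolding mv_dom_parallelization by blast
  define q where "q i = (if \<forall>m. component p i (2 * m) = 0 then 0 else 1 :: nat)" for i
  have "q i \<in> LLPO (component p i)" for i
    using one_mem_LLPO_if_even_nonzero[OF compdom, of i]
    by (auto simp: q_def mem_LLPO_iff[OF compdom])
  then have q: "q \<in> LLPO_hat p" by (simp add: parallelization_def)
  have "z k \<in> LLPO (component q k)" for k
  proof -
    have zero: "component q k (2 * n + b) = 0"
      if "\<And>j. component (rearrange p) k (2 * j + b) = 0" "b < 2" for n b
    proof -
      have "component p (prod_encode (k, 2 * n + b)) (2 * m) = 0" for m
        using that(1)[of "prod_encode (n, m)"] component_rearrange_encode[OF that(2)] by simp
      then show ?thesis by (simp add: component_def[of q] q_def)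
    qed
    have "component q k \<in> mv_dom LLPO"
      using q sub unfolding mv_dom_parallelization by blast
    moreover have "z k = 0 \<and> (\<forall>n. component (rearrange p) k (2 * n) = 0) \<or>
        z k = 1 \<and> (\<forall>n. component (rearrange p) k (2 * n + 1) = 0)"
      using z unfolding parallelization_def LLPO_def by blast
    ultimately show ?thesis
      using zero[of 0] zero[of 1] by (auto simp: mem_LLPO_iff)
  qed
  then have "z \<in> LLPO_hat q" by (simp add: parallelization_def)
  with q dom sub show "z \<in> (LLPO_hat \<circ>\<^sub>m\<^sub>v LLPO_hat) p" unfolding mv_comp_def by blast
qed

theorem lemma7p1: "LLPO_hat \<circ>\<^sub>m\<^sub>v LLPO_hat \<le>\<^sub>s\<^sub>W LLPO_hat"
  unfolding sW_reducible_def
proof (intro exI conjI allI impI)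
  show "computable (\<lambda>p. Some p)"
    by (intro computable_if_oracle_recursive oracle_recursive_query oracle_recursive_proj) simp
  show "computable (\<lambda>p. Some (rearrange p))" by (rule computable_rearrange)
  fix G assume G: "realizer G LLPO_hat"
  show "realizer ((\<lambda>p. Some p) \<circ>\<^sub>m G \<circ>\<^sub>m (\<lambda>p. Some (rearrange p))) (LLPO_hat \<circ>\<^sub>m\<^sub>v LLPO_hat)"
    unfolding realizer_def mv_dom_comp
  proof
    fix p assume "p \<in> {x \<in> mv_dom LLPO_hat. LLPO_hat x \<subseteq> mv_dom LLPO_hat}"
    then have p: "p \<in> mv_dom LLPO_hat" "LLPO_hat p \<subseteq> mv_dom LLPO_hat" by simp_all
    obtain z where "G (rearrange p) = Some z" "z \<in> LLPO_hat (rearrange p)"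
      using G rearrange_in_dom[OF p] unfolding realizer_def by blast
    with LLPO_hat_rearrange_subset_comp[OF p]
    show "\<exists>z. ((\<lambda>p. Some p) \<circ>\<^sub>m G \<circ>\<^sub>m (\<lambda>p. Some (rearrange p))) p = Some z \<and>
        z \<in> (LLPO_hat \<circ>\<^sub>m\<^sub>v LLPO_hat) p"
      by (auto simp: map_comp_def)
  qed
qed

end
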